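(* Let $A(z)=a_2z^2+a_1z+a_0$ and $B(z)=b_2z^2+b_1z+b_0$ be complex polynomials of degree at most $2$, with $A$ not identically zero. Let $w$ be a weight function on the unit circle satisfying the Pearson-type equation $$\frac{w'(\theta)}{w(\theta)}=\frac{B(e^{i\theta})-ie^{i\theta}A'(e^{i\theta})}{A(e^{i\theta})},\qquad\text{equivalently}\qquad \frac{d}{d\theta}\big[A(e^{i\theta})w(\theta)\big]=B(e^{i\theta})w(\theta),$$ and $A(1)[w(2\pi)-w(0)]=0$. Let $\Phi_n$ be the monic orthogonal polynomials on the unit circle with respect to $w$ and $\alpha_n$ their Verblunsky coefficients. Then for all $n\ge 2$ $$A(z)\Phi_n'(z)=n a_2\Phi_{n+1}(z)+s_{n,n}\Phi_n(z)+s_{n,n-1}\Phi_{n-1}(z)+t_n\Phi_n^*(z),$$ where $$t_n=(ib_2+a_2)\overline{\alpha}_n,\qquad s_{n,n-1}=(ib_0+na_0)(1-|\alpha_{n-1}|^2),$$ $$s_{n,n}=na_1-a_2\gamma_n+[ib_2-(n-1)a_2]\,\overline{\alpha}_n\alpha_{n-1}.$$ Moreover, $s_{n,n}$ can also be written as $$s_{n,n}=ib_1+(n+1)a_1-a_0\overline{\gamma}_n-[ib_0+(n+1)a_0]\,\alpha_n\overline{\alpha}_{n-1}.$$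
   Context: A weight function on the unit circle is a nonnegative integrable function $w$ on $[0,2\pi]$, positive almost everywhere, with inner product $\langle f,g\rangle=\int_0^{2\pi}f(e^{i\theta})\overline{g(e^{i\theta})}\,w(\theta)\,d\theta$. The monic orthogonal polynomials on the unit circle (MOPUC) $\Phi_n$ ($n\ge0$) are the monic polynomials of degree $n$ with $\langle\Phi_n,z^k\rangle=0$ for $0\le k\le n-1$. The reciprocal polynomial is $\Phi_n^*(z)=z^n\overline{\Phi_n(1/\overline z)}$. The Verblunsky coefficients are $\alpha_{n-1}=-\overline{\Phi_n(0)}$ for $n\ge0$ (so $\alpha_{-1}=-1$). Set $\gamma_0=0$ and $\gamma_n=\sum_{j=0}^{n-1}\overline{\alpha}_j\alpha_{j-1}$ for $n\ge1$; $\gamma_n$ is the coefficient of $z^{n-1}$ in $\Phi_n$. The Pearson-type equation is understood in the sense that $\theta\mapsto A(e^{i\theta})w(\theta)$ is (extends to) an absolutely continuous function on $[0,2\pi]$ whose derivative equals $B(e^{i\theta})w(\theta)$ almost everywhere, and $A(1)[w(2\pi)-w(0)]$ denotes the difference of the values of this function at $2\pi$ and at $0$ (so $w$ itself may be unbounded near a zero of $A$). Here $A'$ is the derivative of $A$ with respect to $z$. *)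

theory Defs
  imports "HOL-Analysis.Analysis" "HOL-Computational_Algebra.Polynomial"
begin

definition circle_weight :: "(real \<Rightarrow> real) \<Rightarrow> bool" where
  "circle_weight w \<longleftrightarrow>
     set_integrable lebesgue {0..2*pi} w \<and>
     (\<forall>\<theta>\<in>{0..2*pi}. 0 \<le> w \<theta>) \<and>
     (AE \<theta> in lebesgue. \<theta> \<in> {0..2*pi} \<longrightarrow> 0 < w \<theta>)"

definition circle_inner ::
    "(real \<Rightarrow> real) \<Rightarrow> (complex \<Rightarrow> complex) \<Rightarrow> (complex \<Rightarrow> complex) \<Rightarrow> complex" where
  "circle_inner w f g =
     (LINT \<theta>:{0..2*pi}|lebesgue. f (cis \<theta>) * cnj (g (cis \<theta>)) * complex_of_real (w \<theta>))"

definition is_mopuc :: "(real \<Rightarrow> real) \<Rightarrow> (nat \<Rightarrow> complex poly) \<Rightarrow> bool" where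
  "is_mopuc w \<Phi> \<longleftrightarrow>
     (\<forall>n. degree (\<Phi> n) = n \<and> lead_coeff (\<Phi> n) = 1 \<and>
        (\<forall>k<n. circle_inner w (poly (\<Phi> n)) (\<lambda>z. z ^ k) = 0))"

(* The degree of p plays the role of n; for the MOPUC the two agree. *)
definition reciprocal_poly :: "complex poly \<Rightarrow> complex poly" where
  "reciprocal_poly p = map_poly cnj (reflect_poly p)"

lemma poly_reciprocal_poly:
  assumes "z \<noteq> 0"
  shows "poly (reciprocal_poly p) z = z ^ degree p * cnj (poly p (1 / cnj z))"
  using assms by (simp add: reciprocal_poly_def poly_reflect_poly_nz divide_inverse)

(* Indexed by the integers k \<ge> -1, so that the coefficient with index -1 is available.
   Values at k < -1 carry no meaning. *)
definition verblunsky :: "(nat \<Rightarrow> complex poly) \<Rightarrow> int \<Rightarrow> complex" where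
  "verblunsky \<Phi> k = - cnj (poly (\<Phi> (nat (k + 1))) 0)"

definition verblunsky_gamma :: "(int \<Rightarrow> complex) \<Rightarrow> nat \<Rightarrow> complex" where
  "verblunsky_gamma \<alpha> n = (\<Sum>j<n. cnj (\<alpha> (int j)) * \<alpha> (int j - 1))"

(* Absolute continuity of a function on [a,b]; D is a finite family of non-overlapping
   subintervals [u,v], given by their endpoints. *)
definition abs_continuous_on_interval ::
    "real \<Rightarrow> real \<Rightarrow> (real \<Rightarrow> 'a::real_normed_vector) \<Rightarrow> bool" where
  "abs_continuous_on_interval a b F \<longleftrightarrow>
     (\<forall>\<epsilon>>0. \<exists>\<delta>>0. \<forall>D :: (real \<times> real) set.
        finite D \<and>
        (\<forall>(u, v)\<in>D. a \<le> u \<and> u < v \<and> v \<le> b) \<and>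
        pairwise (\<lambda>(u, v) (u', v'). disjnt {u<..<v} {u'<..<v'}) D \<and>
        (\<Sum>(u, v)\<in>D. v - u) < \<delta>
        \<longrightarrow> (\<Sum>(u, v)\<in>D. norm (F v - F u)) < \<epsilon>)"

(* F is the absolutely continuous representative of the function A(e^{i theta}) w(theta) on
   [0, 2 pi], and the Pearson equation (A w)' = B w holds for it. The two functions need only
   agree almost everywhere, because w may be unbounded near a zero of A on the circle.
   Being continuous, F is determined on [0, 2 pi] by A and w, and F (2 pi) - F 0 is the
   meaning of the boundary term A(1) [w(2 pi) - w(0)]. *)
definition pearson_equation ::
    "complex poly \<Rightarrow> complex poly \<Rightarrow> (real \<Rightarrow> real) \<Rightarrow> (real \<Rightarrow> complex) \<Rightarrow> bool" where
  "pearson_equation A B w F \<longleftrightarrow>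
     abs_continuous_on_interval 0 (2*pi) F \<and>
     (AE \<theta> in lebesgue. \<theta> \<in> {0..2*pi} \<longrightarrow>
        F \<theta> = poly A (cis \<theta>) * complex_of_real (w \<theta>)) \<and>
     (AE \<theta> in lebesgue. \<theta> \<in> {0..2*pi} \<longrightarrow>
        (F has_vector_derivative poly B (cis \<theta>) * complex_of_real (w \<theta>))
          (at \<theta> within {0..2*pi}))"

end

theory Submission
  imports Defs
begin

text \<open>
  The weight enters only through its trigonometric moments
  \<open>c k = \<integral> e^(i k \<theta>) w(\<theta>) d\<theta>\<close>, with \<open>k\<close> an integer. The pairing of a polynomial \<open>p\<close> with
  \<open>z^k\<close> is a linear combination of moments, and it makes sense for negative \<open>k\<close> as well.

  The Pearson equation becomes a three-term recurrence for the moments: multiply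
  \<open>d/d\<theta> [A w] = B w\<close> by \<open>e^(i k \<theta>)\<close> and integrate by parts. The boundary term vanishes
  because \<open>A w\<close> takes the same value at both ends of the interval
  (\<open>pearson_trig_moments\<close>). The integration by parts rests on the fundamental theorem of
  calculus for absolutely continuous functions (\<open>abs_continuous_fundamental_theorem\<close>). By
  linearity the recurrence expresses the pairing of \<open>A p'\<close> with \<open>z^k\<close> through the pairings of
  \<open>p\<close> with \<open>z^(k+1)\<close>, \<open>z^k\<close>, \<open>z^(k-1)\<close> (\<open>moment_pairing_pearson\<close>).

  Take \<open>p = \<Phi>\<^sub>n\<close>. Orthogonality leaves \<open>A \<Phi>\<^sub>n'\<close> with nonzero pairings against \<open>z^k\<close>,
  \<open>0 \<le> k < n\<close>, only at the two ends \<open>k = 0\<close> and \<open>k = n - 1\<close>. The reciprocal polynomial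
  \<open>\<Phi>\<^sub>n\<^sup>*\<close> is orthogonal to \<open>z, ..., z^n\<close> and so corrects \<open>k = 0\<close>; the polynomial
  \<open>\<Phi>\<^sub>n\<^sub>-\<^sub>1\<close> corrects \<open>k = n - 1\<close>; and a multiple of \<open>\<Phi>\<^sub>n\<^sub>+\<^sub>1\<close> removes the term of degree
  \<open>n + 1\<close>. What remains has degree at most \<open>n\<close> and is orthogonal to all lower powers, so it is
  a multiple of \<open>\<Phi>\<^sub>n\<close> (\<open>remainder_eq\<close>). That multiple can be read off in two ways: from the
  coefficient of \<open>z^n\<close>, or from the pairing with \<open>z^n\<close>. This gives the two formulas for
  \<open>s\<^sub>n\<^sub>,\<^sub>n\<close>. The ingredients are the Szego recursion and, derived from it, the squared norms of
  the \<open>\<Phi>\<^sub>n\<close> and the pairing of \<open>\<Phi>\<^sub>n\<close> with \<open>z^(n+1)\<close> (\<open>szego_recursion\<close>, \<open>norm2_Suc\<close>,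
  \<open>pairing_Suc_degree\<close>).
\<close>

section \<open>The fundamental theorem of calculus for absolutely continuous functions\<close>

definition nonoverlapping_in :: "real \<Rightarrow> real \<Rightarrow> (real \<times> real) set \<Rightarrow> bool" where
  "nonoverlapping_in a b D \<longleftrightarrow> finite D \<and> (\<forall>(u, v)\<in>D. a \<le> u \<and> u < v \<and> v \<le> b) \<and>
     pairwise (\<lambda>(u, v) (u', v'). disjnt {u<..<v} {u'<..<v'}) D"

lemma abs_continuous_on_interval_iff:
  "abs_continuous_on_interval a b F \<longleftrightarrow>
     (\<forall>\<epsilon>>0. \<exists>\<delta>>0. \<forall>D. nonoverlapping_in a b D \<and> (\<Sum>(u, v)\<in>D. v - u) < \<delta>
        \<longrightarrow> (\<Sum>(u, v)\<in>D. norm (F v - F u)) < \<epsilon>)"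
  unfolding abs_continuous_on_interval_def nonoverlapping_in_def by (simp only: conj_assoc)

lemma abs_continuous_on_intervalE:
  assumes "abs_continuous_on_interval a b F" and "0 < e"
  obtains d where "d > 0"
    and "\<And>D. nonoverlapping_in a b D \<Longrightarrow> (\<Sum>(u, v)\<in>D. v - u) < d
           \<Longrightarrow> (\<Sum>(u, v)\<in>D. norm (F v - F u)) < e"
  using assms(1)[unfolded abs_continuous_on_interval_iff, rule_format, OF assms(2)] by blast

lemma abs_continuous_on_interval_continuous:
  assumes "abs_continuous_on_interval a b F"
  shows "continuous_on {a..b} F"
  unfolding continuous_on_iff
proof (intro ballI allI impI)
  fix x and e :: real assume x: "x \<in> {a..b}" and e: "0 < e"
  obtain d where d: "d > 0" and ac: "\<And>D. nonoverlapping_in a b D \<Longrightarrow>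
        (\<Sum>(u, v)\<in>D. v - u) < d \<Longrightarrow> (\<Sum>(u, v)\<in>D. norm (F v - F u)) < e"
    using abs_continuous_on_intervalE[OF assms e] by blast
  have small: "norm (F v - F u) < e" if "a \<le> u" "u < v" "v \<le> b" "v - u < d" for u v
    using ac[of "{(u, v)}"] that by (auto simp: nonoverlapping_in_def)
  show "\<exists>d>0. \<forall>x'\<in>{a..b}. dist x' x < d \<longrightarrow> dist (F x') (F x) < e"
  proof (intro exI[of _ d] conjI ballI impI d)
    fix y assume y: "y \<in> {a..b}" "dist y x < d"
    consider "y < x" | "y = x" | "x < y" by linarith
    then show "dist (F y) (F x) < e"
    proof cases
      case 1 then show ?thesis using small[of y x] x y by (auto simp: dist_norm norm_minus_commute)
    next
      case 2 then show ?thesis using e by simp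
    next
      case 3 then show ?thesis using small[of x y] x y by (auto simp: dist_norm)
    qed
  qed
qed

text \<open>
  In each increment of the product the factor \<open>cis\<close> is Lipschitz and \<open>F\<close> is bounded by
  compactness, so the sum of the increments is controlled by the total length plus the
  variation of \<open>F\<close>.
\<close>

lemma abs_continuous_on_interval_cis_mult:
  fixes F :: "real \<Rightarrow> complex" and c :: real
  assumes ac: "abs_continuous_on_interval a b F"
  shows "abs_continuous_on_interval a b (\<lambda>\<theta>. cis (c * \<theta>) * F \<theta>)"
  unfolding abs_continuous_on_interval_iff
proof (intro allI impI)
  fix e :: real assume e: "0 < e"
  have "bounded (F ` {a..b})"
    by (intro compact_imp_bounded compact_continuous_image
        abs_continuous_on_interval_continuous[OF ac]) simp
  then obtain M where M: "M > 0" "\<And>x. x \<in> {a..b} \<Longrightarrow> norm (F x) \<le> M"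
    unfolding bounded_pos by blast
  obtain d where d: "d > 0" and acD: "\<And>D. nonoverlapping_in a b D \<Longrightarrow>
        (\<Sum>(u, v)\<in>D. v - u) < d \<Longrightarrow> (\<Sum>(u, v)\<in>D. norm (F v - F u)) < e / 2"
    using abs_continuous_on_intervalE[OF ac half_gt_zero[OF e]] by blast
  \<comment> \<open>The summand 1 keeps \<open>L\<close> positive when \<open>c = 0\<close>.\<close>
  define L where "L = (\<bar>c\<bar> + 1) * M"
  have L: "L > 0" using M by (simp add: L_def)
  have cis_lip: "norm (cis (c * v) - cis (c * u)) \<le> (\<bar>c\<bar> + 1) * (v - u)" if "u < v" for u v
  proof -
    have "cis (c * v) - cis (c * u) = cis (c * u) * (cis (c * (v - u)) - 1)"
      by (simp add: right_diff_distrib cis_mult)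
    then have "norm (cis (c * v) - cis (c * u)) = norm (exp (\<i> * of_real (c * (v - u))) - 1)"
      by (simp add: norm_mult cis_conv_exp)
    also have "\<dots> \<le> \<bar>c * (v - u)\<bar>"
      unfolding dist_exp_i_1 using abs_sin_x_le_abs_x[of "c * (v - u) / 2"] by simp
    also have "\<dots> \<le> (\<bar>c\<bar> + 1) * (v - u)"
      using that by (simp add: abs_mult)
    finally show ?thesis .
  qed
  show "\<exists>\<delta>>0. \<forall>D. nonoverlapping_in a b D \<and>
        (\<Sum>(u, v)\<in>D. v - u) < \<delta>
        \<longrightarrow> (\<Sum>(u, v)\<in>D. norm (cis (c * v) * F v - cis (c * u) * F u)) < e"
  proof (intro exI[of _ "min d (e / (2 * L))"] conjI allI impI)
    show "0 < min d (e / (2 * L))" using d e L by simp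
  next
    fix D
    assume D: "nonoverlapping_in a b D \<and>
        (\<Sum>(u, v)\<in>D. v - u) < min d (e / (2 * L))"
    have "(\<Sum>(u, v)\<in>D. norm (cis (c * v) * F v - cis (c * u) * F u))
          \<le> (\<Sum>(u, v)\<in>D. L * (v - u) + norm (F v - F u))"
    proof (rule sum_mono, clarsimp)
      fix u v assume "(u, v) \<in> D"
      then have uv: "a \<le> u" "u < v" "v \<le> b" using D by (auto simp: nonoverlapping_in_def)
      have "cis (c * v) * F v - cis (c * u) * F u
          = (cis (c * v) - cis (c * u)) * F v + cis (c * u) * (F v - F u)"
        by (simp add: algebra_simps)
      then have "norm (cis (c * v) * F v - cis (c * u) * F u)
          \<le> norm (cis (c * v) - cis (c * u)) * norm (F v) + norm (F v - F u)"
        by (metis norm_cis norm_mult norm_triangle_ineq mult_1)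
      also have "norm (cis (c * v) - cis (c * u)) * norm (F v) \<le> ((\<bar>c\<bar> + 1) * (v - u)) * M"
        using cis_lip[OF uv(2)] M uv by (intro mult_mono) auto
      finally show "norm (cis (c * v) * F v - cis (c * u) * F u) \<le> L * (v - u) + norm (F v - F u)"
        by (simp add: L_def mult_ac)
    qed
    also have "\<dots> = L * (\<Sum>(u, v)\<in>D. v - u) + (\<Sum>(u, v)\<in>D. norm (F v - F u))"
      by (simp add: sum.distrib case_prod_beta sum_distrib_left)
    also have "\<dots> < e / 2 + e / 2"
    proof (rule add_strict_mono)
      show "L * (\<Sum>(u, v)\<in>D. v - u) < e / 2"
        using D L by (simp add: field_simps)
      show "(\<Sum>(u, v)\<in>D. norm (F v - F u)) < e / 2"
        using D by (intro acD) auto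
    qed
    finally show "(\<Sum>(u, v)\<in>D. norm (cis (c * v) * F v - cis (c * u) * F u)) < e" by simp
  qed
qed

text \<open>
  The tag \<open>x\<close> lies between the end points, so the two errors of the linear approximation at
  \<open>x\<close> add up to a multiple of the length of the interval.
\<close>

lemma straddle:
  fixes F :: "real \<Rightarrow> 'a::real_normed_vector"
  assumes u: "norm (F u - F x - (u - x) *\<^sub>R f') \<le> e * norm (u - x)"
    and v: "norm (F v - F x - (v - x) *\<^sub>R f') \<le> e * norm (v - x)"
    and le: "u \<le> x" "x \<le> v"
  shows "norm ((v - u) *\<^sub>R f' - (F v - F u)) \<le> e * (v - u)"
proof -
  have "norm ((v - u) *\<^sub>R f' - (F v - F u)) =
      norm ((F u - F x - (u - x) *\<^sub>R f') - (F v - F x - (v - x) *\<^sub>R f'))"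
    by (simp add: algebra_simps)
  also have "\<dots> \<le> e * norm (u - x) + e * norm (v - x)"
    by (rule order_trans[OF norm_triangle_ineq4 add_mono[OF u v]])
  also have "\<dots> = e * (v - u)"
    using le by (simp add: algebra_simps)
  finally show ?thesis .
qed

text \<open>
  This carries the definition of absolute continuity over to tagged divisions. The cells are
  not quite a family of nonoverlapping intervals: several tags may share a degenerate cell.
  Degenerate cells contribute nothing to the sum, and the others are determined by their
  end points.
\<close>

lemma abs_continuous_variation_on_small_set:
  fixes F :: "real \<Rightarrow> 'a::real_normed_vector"
  assumes ac: "\<And>D. nonoverlapping_in a b D \<Longrightarrow> (\<Sum>(u, v)\<in>D. v - u) < d
        \<Longrightarrow> (\<Sum>(u, v)\<in>D. norm (F v - F u)) < e"
    and p: "p tagged_partial_division_of {a..b}"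
    and T: "T \<in> lmeasurable" "measure lebesgue T < d"
    and sub: "\<And>x K. (x, K) \<in> p \<Longrightarrow> K \<subseteq> T"
  shows "(\<Sum>(x, K)\<in>p. norm (F (Sup K) - F (Inf K))) < e"
proof -
  note pD = tagged_partial_division_ofD[OF p]
  define q where "q = {(x, K) \<in> p. Inf K < Sup K}"
  define en where "en = (\<lambda>(x :: real, K :: real set). (Inf K, Sup K))"
  have K: "\<exists>u v. K = {u..v} \<and> u \<le> v \<and> a \<le> u \<and> v \<le> b \<and> Inf K = u \<and> Sup K = v"
    if xK: "(x, K) \<in> p" for x K
  proof -
    obtain u v where uv: "K = {u..v}" using pD(4)[OF xK] by (auto simp: box_real)
    have "x \<in> K" using pD(2)[OF xK] .
    then have le: "u \<le> v" using uv by auto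
    have "a \<le> u" "v \<le> b" using pD(3)[OF xK] uv le by auto
    then show ?thesis using uv le by auto
  qed
  have q_sub: "q \<subseteq> p" by (auto simp: q_def)
  have fin_q: "finite q" using q_sub pD(1) finite_subset by blast
  have qI: "interior K = {Inf K<..<Sup K}" if xK: "(x, K) \<in> q" for x K
  proof -
    have "(x, K) \<in> p" using xK q_sub by blast
    then obtain u v where "K = {u..v}" "Inf K = u" "Sup K = v" using K by blast
    then show ?thesis by (simp add: interior_atLeastAtMost_real)
  qed
  have disj: "{Inf K<..<Sup K} \<inter> {Inf K'<..<Sup K'} = {}"
    if "(x, K) \<in> q" "(x', K') \<in> q" "(x, K) \<noteq> (x', K')" for x K x' K'
    using pD(5)[of x K x' K'] that q_sub qI by blast
  have inj: "inj_on en q"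
  proof (rule inj_onI)
    fix y y' assume yy: "y \<in> q" "y' \<in> q" "en y = en y'"
    obtain x K x' K' where [simp]: "y = (x, K)" "y' = (x', K')" by (metis surj_pair)
    show "y = y'"
    proof (rule ccontr)
      assume "y \<noteq> y'"
      then have "{Inf K<..<Sup K} = {}" using disj[of x K x' K'] yy by (simp add: en_def)
      moreover have "Inf K < Sup K" using yy by (simp add: q_def)
      ultimately show False by auto
    qed
  qed
  have pw: "pairwise (\<lambda>(u, v) (u', v'). disjnt {u<..<v} {u'<..<v'}) (en ` q)"
    unfolding pairwise_def using disj by (fastforce simp: en_def disjnt_def)
  have "(\<Sum>(x, K)\<in>p. norm (F (Sup K) - F (Inf K))) = (\<Sum>(x, K)\<in>q. norm (F (Sup K) - F (Inf K)))"
  proof (rule sum.mono_neutral_right[OF pD(1) q_sub], clarsimp)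
    fix x K assume xK: "(x, K) \<in> p" "(x, K) \<notin> q"
    then have "Inf K = Sup K" using K[of x K] by (fastforce simp: q_def)
    then show "F (Sup K) = F (Inf K)" by simp
  qed
  also have "\<dots> = (\<Sum>(u, v)\<in>en ` q. norm (F v - F u))"
    by (subst sum.reindex[OF inj]) (auto simp: en_def intro!: sum.cong)
  also have "\<dots> < e"
  proof (rule ac)
    show "nonoverlapping_in a b (en ` q)"
      unfolding nonoverlapping_in_def
      using K q_sub fin_q pw by (fastforce simp: en_def q_def)
    have neg: "pairwise (\<lambda>D D'. negligible
        ((case D of (u, v) \<Rightarrow> {u<..<v}) \<inter> (case D' of (u, v) \<Rightarrow> {u<..<v}))) (en ` q)"
      by (rule pairwise_mono[OF pw]) (auto simp: disjnt_def)
    have "(\<Sum>(u, v)\<in>en ` q. v - u) = (\<Sum>D\<in>en ` q. measure lebesgue (case D of (u, v) \<Rightarrow> {u<..<v}))"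
      by (intro sum.cong) (auto simp: en_def q_def)
    also have "\<dots> = measure lebesgue (\<Union>((\<lambda>(u, v). {u<..<v}) ` en ` q))"
      by (subst measure_negligible_finite_Union_image)
        (use fin_q neg in auto)
    also have "\<dots> \<le> measure lebesgue T"
    proof (rule measure_mono_fmeasurable)
      show "\<Union>((\<lambda>(u, v). {u<..<v}) ` en ` q) \<subseteq> T"
      proof (clarsimp simp: en_def)
        fix y x K assume "(x, K) \<in> q" "Inf K < y" "y < Sup K"
        then show "y \<in> T" using K[of x K] sub[of x K] q_sub by fastforce
      qed
    qed (use fin_q T in \<open>auto intro!: sets.finite_UN split: prod.split\<close>)
    finally show "(\<Sum>(u, v)\<in>en ` q. v - u) < d" using T by simp
  qed
  finally show ?thesis .
qed

text \<open>
  Only the Henstock gauge needs to be chosen. At a point outside the exceptional set the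
  gauge comes from differentiability, as in the classical proof. At a point of the exceptional
  set it is an open set \<open>T\<close> of small measure that contains the exceptional set; the cells
  tagged there lie in \<open>T\<close>, so absolute continuity makes the total increment of \<open>F\<close> over them
  small. Integrability of \<open>f\<close> comes out as part of the result.
\<close>

theorem abs_continuous_fundamental_theorem:
  fixes F :: "real \<Rightarrow> 'a::banach"
  assumes ab: "a \<le> b" and ac: "abs_continuous_on_interval a b F"
    and N: "negligible N"
    and deriv: "\<And>x. x \<in> {a..b} - N \<Longrightarrow> (F has_vector_derivative f x) (at x within {a..b})"
  shows "(f has_integral (F b - F a)) {a..b}"
proof -
  define g where "g x = (if x \<in> N then 0 else f x)" for x
  have "(g has_integral (F b - F a)) {a..b}"
    unfolding has_integral_real
  proof (intro allI impI)
    fix e :: real assume e: "0 < e"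
    \<comment> \<open>The summand 1 covers the case \<open>a = b\<close>.\<close>
    define r where "r = e / (2 * (b - a + 1))"
    have r: "r > 0" using e ab by (simp add: r_def)
    obtain d where d: "d > 0" and acD: "\<And>D. nonoverlapping_in a b D \<Longrightarrow>
        (\<Sum>(u, v)\<in>D. v - u) < d \<Longrightarrow> (\<Sum>(u, v)\<in>D. norm (F v - F u)) < e / 2"
      using abs_continuous_on_intervalE[OF ac half_gt_zero[OF e]] by blast
    obtain T where T: "open T" "N \<subseteq> T" "T - N \<in> lmeasurable" "emeasure lebesgue (T - N) < ennreal d"
      using sets_lebesgue_outer_open[of N d] N d negligible_imp_sets by blast
    have T_eq: "T = (T - N) \<union> N" using T by auto
    have Tm: "T \<in> lmeasurable"
      using T(3) N T_eq by (metis fmeasurable.Un negligible_imp_measurable)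
    have "measure lebesgue T = measure lebesgue (T - N)"
      by (metis measure_Diff_null_set N Tm fmeasurableD negligible_iff_null_sets)
    also have "\<dots> < d"
      using T(3,4) d by (simp add: emeasure_eq_measure2 ennreal_less_iff)
    finally have Td: "measure lebesgue T < d" .
    have "\<forall>x. \<exists>\<rho>>0. x \<in> {a..b} - N \<longrightarrow>
         (\<forall>y\<in>{a..b}. norm (y - x) < \<rho> \<longrightarrow> norm (F y - F x - (y - x) *\<^sub>R f x) \<le> r * norm (y - x))"
      using deriv r unfolding has_vector_derivative_def has_derivative_within_alt
      by (metis DiffD1 zero_less_one)
    then obtain \<rho> where \<rho>: "\<And>x. 0 < \<rho> x"
        "\<And>x y. \<lbrakk>x \<in> {a..b} - N; y \<in> {a..b}; norm (y - x) < \<rho> x\<rbrakk>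
           \<Longrightarrow> norm (F y - F x - (y - x) *\<^sub>R f x) \<le> r * norm (y - x)"
      by metis
    define G where "G x = (if x \<in> N then T else ball x (\<rho> x))" for x
    show "\<exists>\<gamma>. gauge \<gamma> \<and> (\<forall>\<D>. \<D> tagged_division_of {a..b} \<and> \<gamma> fine \<D> \<longrightarrow>
        norm ((\<Sum>(x, k)\<in>\<D>. measure lborel k *\<^sub>R g x) - (F b - F a)) < e)"
    proof (intro exI[of _ G] conjI allI impI)
      show "gauge G" using T \<rho>(1) by (auto simp: gauge_def G_def)
    next
      fix p assume "p tagged_division_of {a..b} \<and> G fine p"
      then have p: "p tagged_division_of {a..b}" and fine: "G fine p" by auto
      note pD = tagged_division_ofD[OF p]
      have ba: "(\<Sum>(x, K)\<in>p. Sup K - Inf K) = b - a"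
        and Fba: "(\<Sum>(x, K)\<in>p. F (Sup K) - F (Inf K)) = F b - F a"
        using additive_tagged_division_1[OF ab p, of "\<lambda>x. x"]
          additive_tagged_division_1[OF ab p, of F] by auto
      define pN where "pN = {(x, K) \<in> p. x \<in> N}"
      have pN: "pN tagged_partial_division_of {a..b}"
        using p tagged_partial_division_subset[of p "{a..b}" pN]
        by (auto simp: pN_def tagged_division_of_def)
      have sumN: "(\<Sum>(x, K)\<in>pN. norm (F (Sup K) - F (Inf K))) < e / 2"
      proof (rule abs_continuous_variation_on_small_set[OF acD pN Tm Td])
        fix x K assume "(x, K) \<in> pN"
        then show "K \<subseteq> T" using fine by (fastforce simp: pN_def G_def fine_def)
      qed
      have bound: "norm (measure lborel K *\<^sub>R g x - (F (Sup K) - F (Inf K)))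
          \<le> r * (Sup K - Inf K) + (if x \<in> N then norm (F (Sup K) - F (Inf K)) else 0)"
        if xK: "(x, K) \<in> p" for x K
      proof -
        obtain u v where uv: "K = {u..v}" using pD(4)[OF xK] by (auto simp: box_real)
        have x: "x \<in> K" "K \<subseteq> {a..b}" using pD(2,3)[OF xK] by auto
        then have le: "u \<le> x" "x \<le> v" "u \<le> v" using uv by auto
        show ?thesis
        proof (cases "x \<in> N")
          case True
          then show ?thesis using le r uv by (simp add: g_def norm_minus_commute)
        next
          case False
          have "K \<subseteq> G x" using fine xK by (auto simp: fine_def)
          then have "K \<subseteq> ball x (\<rho> x)" using False by (simp add: G_def)
          moreover have "u \<in> K" "v \<in> K" using uv le by auto
          ultimately have "norm (u - x) < \<rho> x" "norm (v - x) < \<rho> x"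
            by (auto simp: subset_iff dist_norm norm_minus_commute)
          then have "norm ((v - u) *\<^sub>R f x - (F v - F u)) \<le> r * (v - u)"
            using False x uv le by (intro straddle[where x = x] \<rho>(2)) auto
          then show ?thesis using False le uv by (simp add: g_def)
        qed
      qed
      have "norm ((\<Sum>(x, K)\<in>p. measure lborel K *\<^sub>R g x) - (F b - F a))
          = norm (\<Sum>(x, K)\<in>p. measure lborel K *\<^sub>R g x - (F (Sup K) - F (Inf K)))"
        by (simp add: Fba[symmetric] sum_subtractf case_prod_beta)
      also have "\<dots> \<le> (\<Sum>(x, K)\<in>p. r * (Sup K - Inf K)
          + (if x \<in> N then norm (F (Sup K) - F (Inf K)) else 0))"
        by (rule sum_norm_le) (use bound in auto)
      also have "\<dots> = r * (b - a) + (\<Sum>(x, K)\<in>p. if x \<in> N then norm (F (Sup K) - F (Inf K)) else 0)"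
        by (simp add: sum.distrib case_prod_beta sum_distrib_left flip: ba)
      also have "(\<Sum>(x, K)\<in>p. if x \<in> N then norm (F (Sup K) - F (Inf K)) else 0)
          = (\<Sum>(x, K)\<in>pN. norm (F (Sup K) - F (Inf K)))"
        unfolding pN_def using pD(1)
        by (intro sum.mono_neutral_cong_right) (auto split: if_splits)
      also have "r * (b - a) \<le> e / 2"
        using ab e by (simp add: r_def field_simps)
      finally show "norm ((\<Sum>(x, K)\<in>p. measure lborel K *\<^sub>R g x) - (F b - F a)) < e"
        using sumN by simp
    qed
  qed
  then show ?thesis
    by (rule has_integral_spike[OF N, rotated]) (auto simp: g_def)
qed

section \<open>Pairing polynomials with integer powers\<close>

text \<open>
  If \<open>c j\<close> is the moment \<open>\<integral> z^j w\<close>, then this is the inner product of \<open>p\<close> with \<open>z^k\<close> on the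
  unit circle. The exponent \<open>k\<close> is an integer, since \<open>k = - 1\<close> and \<open>k = - 2\<close> occur below.
\<close>

definition moment_pairing :: "(int \<Rightarrow> complex) \<Rightarrow> complex poly \<Rightarrow> int \<Rightarrow> complex" where
  "moment_pairing c p k = (\<Sum>j\<le>degree p. coeff p j * c (int j - k))"

lemma moment_pairing_eq_sum:
  assumes "degree p \<le> N"
  shows "moment_pairing c p k = (\<Sum>j\<le>N. coeff p j * c (int j - k))"
  unfolding moment_pairing_def
  by (rule sum.mono_neutral_left) (use assms in \<open>auto simp: coeff_eq_0\<close>)

lemma moment_pairing_add [simp]:
  "moment_pairing c (p + q) k = moment_pairing c p k + moment_pairing c q k"
proof -
  let ?N = "max (degree p) (degree q)"
  show ?thesis
    using moment_pairing_eq_sum[of p ?N] moment_pairing_eq_sum[of q ?N]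
      moment_pairing_eq_sum[of "p + q" ?N] degree_add_le_max[of p q]
    by (simp add: algebra_simps sum.distrib)
qed

lemma moment_pairing_smult [simp]:
  "moment_pairing c (smult a p) k = a * moment_pairing c p k"
  using moment_pairing_eq_sum[of "smult a p" "degree p"]
  by (simp add: moment_pairing_def degree_smult_le sum_distrib_left mult_ac)

lemma moment_pairing_diff [simp]:
  "moment_pairing c (p - q) k = moment_pairing c p k - moment_pairing c q k"
  using moment_pairing_add[of c "p - q" q k] by (simp del: moment_pairing_add)

lemma moment_pairing_pCons_0 [simp]:
  "moment_pairing c (pCons 0 p) k = moment_pairing c p (k - 1)"
proof -
  have "moment_pairing c (pCons 0 p) k = (\<Sum>j\<le>Suc (degree p). coeff (pCons 0 p) j * c (int j - k))"
    by (rule moment_pairing_eq_sum) (rule degree_pCons_le)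
  also have "\<dots> = (\<Sum>j\<le>degree p. coeff p j * c (int (Suc j) - k))"
    by (subst sum.atMost_Suc_shift) simp
  also have "\<dots> = moment_pairing c p (k - 1)"
    by (simp add: moment_pairing_def algebra_simps)
  finally show ?thesis .
qed

lemma moment_pairing_pderiv:
  "moment_pairing c (pderiv p) k = (\<Sum>j\<le>degree p. of_nat j * coeff p j * c (int j - (k + 1)))"
proof -
  have "(\<Sum>j\<le>Suc (degree p). of_nat j * coeff p j * c (int j - (k + 1)))
      = (\<Sum>j\<le>degree p. of_nat (Suc j) * coeff p (Suc j) * c (int j - k))"
    by (subst sum.atMost_Suc_shift) (simp add: algebra_simps)
  also have "\<dots> = moment_pairing c (pderiv p) k"
    by (subst moment_pairing_eq_sum[of _ "degree p"])
      (simp_all add: degree_pderiv coeff_pderiv)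
  finally show ?thesis by (simp add: coeff_eq_0)
qed

lemma coeff_reciprocal_poly:
  "coeff (reciprocal_poly p) j = (if j \<le> degree p then cnj (coeff p (degree p - j)) else 0)"
  by (simp add: reciprocal_poly_def coeff_map_poly coeff_reflect_poly not_less)

lemma degree_reciprocal_poly_le: "degree (reciprocal_poly p) \<le> degree p"
  by (rule degree_le) (simp add: coeff_reciprocal_poly)

text \<open>
  On the unit circle the reciprocal polynomial is \<open>z^n\<close> times the conjugate of \<open>p\<close>, where
  \<open>n\<close> is the degree.
\<close>

lemma moment_pairing_reciprocal_poly:
  assumes herm: "\<And>k. c (- k) = cnj (c k)"
  shows "moment_pairing c (reciprocal_poly p) k = cnj (moment_pairing c p (int (degree p) - k))"
proof -
  have "moment_pairing c (reciprocal_poly p) k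
      = (\<Sum>j\<le>degree p. cnj (coeff p (degree p - j)) * c (int j - k))"
    by (simp add: moment_pairing_eq_sum[OF degree_reciprocal_poly_le] coeff_reciprocal_poly)
  also have "\<dots> = (\<Sum>j\<le>degree p. cnj (coeff p j) * c (int (degree p - j) - k))"
    by (rule sum.reindex_bij_witness[where i = "\<lambda>j. degree p - j" and j = "\<lambda>j. degree p - j"]) auto
  also have "\<dots> = (\<Sum>j\<le>degree p. cnj (coeff p j) * cnj (c (int j - (int (degree p) - k))))"
    by (intro sum.cong refl) (simp add: of_nat_diff algebra_simps flip: herm)
  finally show ?thesis by (simp add: moment_pairing_def)
qed

text \<open>
  Both sides are linear in \<open>p\<close>. For \<open>p = z^j\<close> the claim is \<open>\<i>\<close> times the recurrence of the
  moments at the index \<open>m = j - (k + 1)\<close>, because \<open>j = m + (k + 1)\<close>.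
\<close>

lemma moment_pairing_pearson:
  assumes pearson: "\<And>k :: int. (b0 + \<i> * of_int k * a0) * c k
      + (b1 + \<i> * of_int k * a1) * c (k + 1) + (b2 + \<i> * of_int k * a2) * c (k + 2) = 0"
  shows "moment_pairing c ([:a0, a1, a2:] * pderiv p) k =
      (of_int (k + 1) * a0 + \<i> * b0) * moment_pairing c p (k + 1)
      + (of_int (k + 1) * a1 + \<i> * b1) * moment_pairing c p k
      + (of_int (k + 1) * a2 + \<i> * b2) * moment_pairing c p (k - 1)"
proof -
  have expand: "[:a0, a1, a2:] * q
      = smult a0 q + pCons 0 (smult a1 q + pCons 0 (smult a2 q))" for q
    by simp
  have "of_nat j * (a0 * c (int j - (k + 1)) + a1 * c (int j - k) + a2 * c (int j - (k - 1)))
      = (of_int (k + 1) * a0 + \<i> * b0) * c (int j - (k + 1))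
      + (of_int (k + 1) * a1 + \<i> * b1) * c (int j - k)
      + (of_int (k + 1) * a2 + \<i> * b2) * c (int j - (k - 1))" for j
  proof -
    define m where "m = int j - (k + 1)"
    have ks: "int j - k = m + 1" "int j - (k - 1) = m + 2" by (simp_all add: m_def)
    have j: "(of_nat j :: complex) = of_int m + of_int (k + 1)" by (simp add: m_def)
    have "\<i> * ((b0 + \<i> * of_int m * a0) * c m + (b1 + \<i> * of_int m * a1) * c (m + 1)
        + (b2 + \<i> * of_int m * a2) * c (m + 2)) = 0"
      by (simp add: pearson)
    then have "of_int m * (a0 * c m + a1 * c (m + 1) + a2 * c (m + 2))
        = \<i> * (b0 * c m + b1 * c (m + 1) + b2 * c (m + 2))"
      by (simp add: algebra_simps)
    then show ?thesis
      unfolding ks m_def[symmetric] j by (simp add: algebra_simps del: of_int_add)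
  qed
  note key = this
  have "moment_pairing c ([:a0, a1, a2:] * pderiv p) k = (\<Sum>j\<le>degree p. coeff p j *
      (of_nat j * (a0 * c (int j - (k + 1)) + a1 * c (int j - k) + a2 * c (int j - (k - 1)))))"
    unfolding expand
    by (simp add: moment_pairing_pderiv sum_distrib_left sum.distrib algebra_simps del: mult_pCons_left)
  also have "\<dots> = (\<Sum>j\<le>degree p. coeff p j * ((of_int (k + 1) * a0 + \<i> * b0) * c (int j - (k + 1))
      + (of_int (k + 1) * a1 + \<i> * b1) * c (int j - k)
      + (of_int (k + 1) * a2 + \<i> * b2) * c (int j - (k - 1))))"
    by (simp only: key)
  also have "\<dots> = (of_int (k + 1) * a0 + \<i> * b0) * moment_pairing c p (k + 1)
      + (of_int (k + 1) * a1 + \<i> * b1) * moment_pairing c p k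
      + (of_int (k + 1) * a2 + \<i> * b2) * moment_pairing c p (k - 1)"
    unfolding moment_pairing_def sum_distrib_left
    by (simp only: sum.distrib distrib_left mult.left_commute)
  finally show ?thesis .
qed

section \<open>Monic orthogonal polynomials and their Verblunsky coefficients\<close>

text \<open>
  Definiteness is required of polynomials of degree below \<open>n\<close>; the condition on the
  coefficients also makes sense for \<open>n = 0\<close>, where it forces \<open>p = 0\<close>.
\<close>

locale opuc_moments =
  fixes c :: "int \<Rightarrow> complex" and \<Phi> :: "nat \<Rightarrow> complex poly"
  assumes hermitian: "\<And>k. c (- k) = cnj (c k)"
    and definite: "\<And>n p. (\<And>j. j \<ge> n \<Longrightarrow> coeff p j = 0) \<Longrightarrow>
          (\<And>k. k < n \<Longrightarrow> moment_pairing c p (int k) = 0) \<Longrightarrow> p = 0"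
    and degree_\<Phi>: "\<And>n. degree (\<Phi> n) = n"
    and monic: "\<And>n. coeff (\<Phi> n) n = 1"
    and orthogonal: "\<And>n k. 0 \<le> k \<Longrightarrow> k < int n \<Longrightarrow> moment_pairing c (\<Phi> n) k = 0"
begin

abbreviation \<alpha> :: "int \<Rightarrow> complex" where "\<alpha> \<equiv> verblunsky \<Phi>"

abbreviation \<gamma> :: "nat \<Rightarrow> complex" where "\<gamma> \<equiv> verblunsky_gamma \<alpha>"

text \<open>
  This is the squared norm of \<open>\<Phi>\<^sub>n\<close>, since \<open>\<Phi>\<^sub>n\<close> differs from \<open>z^n\<close> by lower powers.
\<close>

definition norm2 :: "nat \<Rightarrow> complex" where
  "norm2 n = moment_pairing c (\<Phi> n) (int n)"

lemma gamma_Suc: "\<gamma> (Suc n) = \<gamma> n + cnj (\<alpha> (int n)) * \<alpha> (int n - 1)"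
  by (simp add: verblunsky_gamma_def)

lemma alpha_eq: "\<alpha> (int n) = - cnj (coeff (\<Phi> (Suc n)) 0)"
  by (simp add: verblunsky_def poly_0_coeff_0 nat_add_distrib)

lemma alpha_pred_eq: "\<alpha> (int n - 1) = - cnj (coeff (\<Phi> n) 0)"
  by (simp add: verblunsky_def poly_0_coeff_0)

lemma pairing_reciprocal:
  "moment_pairing c (reciprocal_poly (\<Phi> n)) k = cnj (moment_pairing c (\<Phi> n) (int n - k))"
  using moment_pairing_reciprocal_poly[of c, OF hermitian] by (simp add: degree_\<Phi>)

lemma coeff_reciprocal:
  "coeff (reciprocal_poly (\<Phi> n)) j = (if j \<le> n then cnj (coeff (\<Phi> n) (n - j)) else 0)"
  by (simp add: coeff_reciprocal_poly degree_\<Phi>)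

lemma coeff_beyond: "n < j \<Longrightarrow> coeff (\<Phi> n) j = 0"
  by (simp add: coeff_eq_0 degree_\<Phi>)

text \<open>
  The difference of the two sides has degree at most \<open>n\<close>, vanishes at \<open>0\<close> and is orthogonal
  to \<open>z, ..., z^n\<close>. After division by \<open>z\<close> it has degree below \<open>n\<close> and is orthogonal to
  \<open>1, ..., z^(n-1)\<close>, so it is zero.
\<close>

theorem szego_recursion:
  "\<Phi> (Suc n) = pCons 0 (\<Phi> n) - smult (cnj (\<alpha> (int n))) (reciprocal_poly (\<Phi> n))"
proof -
  define d where "d = \<Phi> (Suc n) - pCons 0 (\<Phi> n) + smult (cnj (\<alpha> (int n))) (reciprocal_poly (\<Phi> n))"
  have "coeff d 0 = 0"
    by (simp add: d_def coeff_reciprocal monic alpha_eq)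
  then obtain q where q: "d = pCons 0 q"
    by (metis coeff_pCons_0 pCons_cases)
  have "q = 0"
  proof (rule definite[of n])
    fix j assume j: "n \<le> j"
    have "coeff d (Suc j) = 0"
      using j monic by (cases "j = n") (auto simp: d_def coeff_reciprocal coeff_beyond)
    then show "coeff q j = 0" by (simp add: q)
  next
    fix k assume k: "k < n"
    have "moment_pairing c d (int k + 1) = 0"
      using k by (simp add: d_def pairing_reciprocal orthogonal)
    then show "moment_pairing c q (int k) = 0" by (simp add: q)
  qed
  then have "d = 0" by (simp add: q)
  then show ?thesis by (simp add: d_def algebra_simps)
qed

lemma pairing_Suc:
  "moment_pairing c (\<Phi> (Suc n)) k = moment_pairing c (\<Phi> n) (k - 1)
     - cnj (\<alpha> (int n)) * cnj (moment_pairing c (\<Phi> n) (int n - k))"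
  by (simp add: szego_recursion pairing_reciprocal)

text \<open>
  This is the Szego recursion paired with \<open>1\<close>, to which \<open>\<Phi>\<^sub>n\<^sub>+\<^sub>1\<close> is orthogonal. The
  conjugate disappears once this identity has itself been used to show that the norm is real.
\<close>

lemma pairing_minus_1: "moment_pairing c (\<Phi> n) (- 1) = cnj (\<alpha> (int n)) * cnj (norm2 n)"
  using pairing_Suc[of n 0] orthogonal[of 0 "Suc n"] by (simp add: norm2_def)

lemma norm2_Suc_cnj: "norm2 (Suc n) = norm2 n - cnj (\<alpha> (int n)) * \<alpha> (int n) * norm2 n"
  using pairing_Suc[of n "int n + 1"]
  by (simp add: norm2_def pairing_minus_1 add.commute[of 1])

lemma norm2_Suc: "norm2 (Suc n) = (1 - of_real ((cmod (\<alpha> (int n)))\<^sup>2)) * norm2 n"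
  unfolding norm2_Suc_cnj complex_norm_square by (simp add: algebra_simps)

lemma \<Phi>_0: "\<Phi> 0 = 1"
  using degree_\<Phi>[of 0] monic[of 0] by (metis degree_0_id one_pCons)

lemma cnj_norm2 [simp]: "cnj (norm2 n) = norm2 n"
proof (induction n)
  case 0
  show ?case using hermitian[of 0] by (simp add: norm2_def \<Phi>_0 moment_pairing_def)
next
  case (Suc n)
  then show ?case by (simp add: norm2_Suc)
qed

lemma norm2_nonzero: "norm2 n \<noteq> 0"
proof
  assume "norm2 n = 0"
  have "\<Phi> n = 0"
  proof (rule definite[of "Suc n"])
    fix k assume "k < Suc n"
    then show "moment_pairing c (\<Phi> n) (int k) = 0"
      using \<open>norm2 n = 0\<close> orthogonal[of "int k" n] by (cases "k = n") (auto simp: norm2_def)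
  qed (simp add: coeff_beyond)
  then show False using monic[of n] by simp
qed

lemma coeff_subleading: "coeff (\<Phi> (Suc n)) n = \<gamma> (Suc n)"
proof (induction n)
  case 0
  have "\<alpha> (- 1) = - 1" using alpha_pred_eq[of 0] by (simp add: \<Phi>_0)
  then show ?case using alpha_eq[of 0] by (simp add: verblunsky_gamma_def)
next
  case (Suc n)
  show ?case
    by (subst szego_recursion, subst gamma_Suc)
      (simp add: Suc coeff_reciprocal alpha_pred_eq del: of_nat_Suc)
qed

text \<open>
  Since \<open>\<gamma>\<^sub>n\<^sub>+\<^sub>1\<close> is the subleading coefficient of \<open>\<Phi>\<^sub>n\<^sub>+\<^sub>1\<close>, this says that \<open>\<Phi>\<^sub>n\<close> is orthogonal
  to \<open>\<Phi>\<^sub>n\<^sub>+\<^sub>1\<close>. The induction avoids expanding that double sum: the Szego recursion links the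
  pairings of \<open>\<Phi>\<^sub>n\<close> with \<open>z^(n+1)\<close> and \<open>z^(-2)\<close>, and the latter is eliminated by the known pairing of
  \<open>\<Phi>\<^sub>n\<^sub>+\<^sub>1\<close> with \<open>z^(-1)\<close>.
\<close>

lemma pairing_Suc_degree: "moment_pairing c (\<Phi> n) (int n + 1) = - cnj (\<gamma> (Suc n)) * norm2 n"
proof (induction n)
  case 0
  have "\<alpha> (- 1) = - 1" using alpha_pred_eq[of 0] by (simp add: \<Phi>_0)
  moreover have "moment_pairing c (\<Phi> 0) 1 = cnj (moment_pairing c (\<Phi> 0) (- 1))"
    using hermitian[of 1] by (simp add: \<Phi>_0 moment_pairing_def)
  ultimately show ?case
    by (simp add: pairing_minus_1 verblunsky_gamma_def)
next
  case (Suc n)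
  have "moment_pairing c (\<Phi> (Suc n)) (- 1)
      = moment_pairing c (\<Phi> n) (- 2) - cnj (\<alpha> (int n)) * cnj (moment_pairing c (\<Phi> n) (int n + 1))"
    by (simp add: pairing_Suc)
  then have below: "moment_pairing c (\<Phi> n) (- 2) = cnj (\<alpha> (int n + 1)) * norm2 (Suc n)
      - cnj (\<alpha> (int n)) * \<gamma> (Suc n) * norm2 n"
    using pairing_minus_1[of "Suc n"] Suc by (simp add: algebra_simps)
  have "moment_pairing c (\<Phi> (Suc n)) (int (Suc n) + 1)
      = moment_pairing c (\<Phi> n) (int n + 1) - cnj (\<alpha> (int n)) * cnj (moment_pairing c (\<Phi> n) (- 2))"
    by (simp add: pairing_Suc add.commute)
  also have "\<dots> = - cnj (\<gamma> (Suc n)) * (norm2 n - cnj (\<alpha> (int n)) * \<alpha> (int n) * norm2 n)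
        - cnj (\<alpha> (int n)) * \<alpha> (int n + 1) * norm2 (Suc n)"
    unfolding below Suc by (simp add: algebra_simps)
  also have "\<dots> = - cnj (\<gamma> (Suc (Suc n))) * norm2 (Suc n)"
    unfolding norm2_Suc_cnj[symmetric] gamma_Suc[of "Suc n"]
    by (simp add: algebra_simps)
  finally show ?case .
qed

end

section \<open>The structure relation\<close>

locale semiclassical_moments = opuc_moments +
  fixes A :: "complex poly" and a0 a1 a2 b0 b1 b2 :: complex
  assumes A_eq: "A = [:a0, a1, a2:]"
    and pearson_moments: "\<And>k :: int. (b0 + \<i> * of_int k * a0) * c k
      + (b1 + \<i> * of_int k * a1) * c (k + 1) + (b2 + \<i> * of_int k * a2) * c (k + 2) = 0"
begin

text \<open>
  The next three quantities are the coefficients of \<open>\<Phi>\<^sub>n\<^sub>-\<^sub>1\<close>, \<open>\<Phi>\<^sub>n\<close> and \<open>\<Phi>\<^sub>n\<^sup>*\<close> in the expansion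
  of \<open>A \<Phi>\<^sub>n'\<close>.
\<close>

definition s_lower :: "nat \<Rightarrow> complex" where
  "s_lower n = (\<i> * b0 + of_nat n * a0) * (1 - of_real ((cmod (\<alpha> (int n - 1)))\<^sup>2))"

definition s_diag :: "nat \<Rightarrow> complex" where
  "s_diag n = of_nat n * a1 - a2 * \<gamma> n
     + (\<i> * b2 - (of_nat n - 1) * a2) * cnj (\<alpha> (int n)) * \<alpha> (int n - 1)"

definition t_coeff :: "nat \<Rightarrow> complex" where
  "t_coeff n = (\<i> * b2 + a2) * cnj (\<alpha> (int n))"

definition remainder :: "nat \<Rightarrow> complex poly" where
  "remainder n = A * pderiv (\<Phi> n) - smult (of_nat n * a2) (\<Phi> (Suc n))
     - smult (s_lower n) (\<Phi> (n - 1)) - smult (t_coeff n) (reciprocal_poly (\<Phi> n))"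

lemma pairing_pderiv:
  "moment_pairing c (A * pderiv (\<Phi> n)) k =
      (of_int (k + 1) * a0 + \<i> * b0) * moment_pairing c (\<Phi> n) (k + 1)
      + (of_int (k + 1) * a1 + \<i> * b1) * moment_pairing c (\<Phi> n) k
      + (of_int (k + 1) * a2 + \<i> * b2) * moment_pairing c (\<Phi> n) (k - 1)"
  unfolding A_eq by (rule moment_pairing_pearson) (rule pearson_moments)

lemma coeff_A_mult:
  "coeff (A * q) (Suc (Suc j)) = a0 * coeff q (Suc (Suc j)) + a1 * coeff q (Suc j) + a2 * coeff q j"
  by (simp add: A_eq)

text \<open>
  The factor \<open>1 - |\<alpha>\<^sub>m|\<^sup>2\<close> in the coefficient is the ratio of consecutive squared norms.
\<close>

lemma s_lower_norm2: "s_lower (Suc m) * norm2 m = (\<i> * b0 + of_nat (Suc m) * a0) * norm2 (Suc m)"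
  by (simp add: s_lower_def norm2_Suc)

lemma coeff_remainder_degree:
  assumes "n \<ge> 2"
  shows "coeff (remainder n) n = s_diag n"
proof -
  obtain m where n: "n = Suc (Suc m)" using assms by (metis add_2_eq_Suc le_Suc_ex)
  have "coeff (\<Phi> n) (Suc m) = \<gamma> n" "coeff (\<Phi> (Suc n)) n = \<gamma> n + cnj (\<alpha> (int n)) * \<alpha> (int n - 1)"
    by (simp_all only: n coeff_subleading gamma_Suc)
  moreover have "cnj (coeff (\<Phi> n) 0) = - \<alpha> (int n - 1)"
    by (simp add: alpha_pred_eq)
  ultimately show ?thesis
    using monic[of n] coeff_beyond[of n "Suc n"] coeff_beyond[of "Suc m" n]
    by (simp add: remainder_def n coeff_A_mult coeff_pderiv coeff_reciprocal
        s_diag_def t_coeff_def algebra_simps)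
qed

lemma coeff_remainder_beyond:
  assumes "n \<ge> 2" "j > n"
  shows "coeff (remainder n) j = 0"
proof -
  obtain m where n: "n = Suc (Suc m)" using assms by (metis add_2_eq_Suc le_Suc_ex)
  obtain i where i: "j = Suc (Suc i)" "i > m"
    using assms n by (metis Suc_less_eq2 less_Suc_eq_0_disj Suc_less_eq)
  show ?thesis
    using i
    by (cases "i = Suc m")
      (auto simp: remainder_def n coeff_A_mult coeff_pderiv coeff_beyond monic
        coeff_reciprocal algebra_simps)
qed

text \<open>
  For \<open>0 < k < n - 1\<close> every term vanishes separately. At \<open>k = 0\<close> the pairing of \<open>\<Phi>\<^sub>n\<close> with
  \<open>z^(-1)\<close> survives and is cancelled by the reciprocal polynomial; at \<open>k = n - 1\<close> the squared
  norm of \<open>\<Phi>\<^sub>n\<close> survives and is cancelled by \<open>\<Phi>\<^sub>n\<^sub>-\<^sub>1\<close>. The condition \<open>n \<ge> 2\<close> keeps these two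
  indices apart.
\<close>

lemma remainder_orthogonal:
  assumes n: "n \<ge> 2" and k: "k < n"
  shows "moment_pairing c (remainder n) (int k) = 0"
proof -
  consider "k = 0" | "0 < k" "k < n - 1" | "k = n - 1" using k by linarith
  then show ?thesis
  proof cases
    case 1
    then show ?thesis
      using n pairing_minus_1[of n]
      by (simp add: remainder_def pairing_pderiv pairing_reciprocal orthogonal norm2_def
          t_coeff_def algebra_simps)
  next
    case 2
    then show ?thesis
      by (simp add: remainder_def pairing_pderiv pairing_reciprocal orthogonal)
  next
    case 3
    then obtain m where m: "n = Suc m" "k = m" "0 < m" using n by (cases n) auto
    show ?thesis
      using s_lower_norm2[of m] m
      by (simp add: remainder_def pairing_pderiv pairing_reciprocal orthogonal norm2_def add_ac)
  qed
qed

lemma remainder_eq: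
  assumes n: "n \<ge> 2"
  shows "remainder n = smult (s_diag n) (\<Phi> n)"
proof -
  have "remainder n - smult (s_diag n) (\<Phi> n) = 0"
  proof (rule definite[of n])
    fix j assume "n \<le> j"
    then show "coeff (remainder n - smult (s_diag n) (\<Phi> n)) j = 0"
      using n by (cases "j = n")
        (simp_all add: coeff_remainder_degree coeff_remainder_beyond coeff_beyond monic)
  qed (simp add: remainder_orthogonal[OF n] orthogonal)
  then show ?thesis by simp
qed

theorem structure_relation:
  assumes "n \<ge> 2"
  shows "A * pderiv (\<Phi> n) = smult (of_nat n * a2) (\<Phi> (Suc n)) + smult (s_diag n) (\<Phi> n)
     + smult (s_lower n) (\<Phi> (n - 1)) + smult (t_coeff n) (reciprocal_poly (\<Phi> n))"
  using remainder_eq[OF assms] by (simp add: remainder_def algebra_simps)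

text \<open>
  By \<open>remainder_eq\<close> the coefficient is also the pairing of the remainder with \<open>z^n\<close> divided by
  the squared norm of \<open>\<Phi>\<^sub>n\<close>. Here the pairings of \<open>\<Phi>\<^sub>n\<close> and \<open>\<Phi>\<^sub>n\<^sub>-\<^sub>1\<close> with the power just above
  their degree contribute \<open>\<gamma>\<^sub>n\<^sub>+\<^sub>1\<close> and \<open>\<gamma>\<^sub>n\<close>.
\<close>

theorem s_diag_alternative:
  assumes n: "n \<ge> 2"
  shows "s_diag n = \<i> * b1 + (of_nat n + 1) * a1 - a0 * cnj (\<gamma> n)
     - (\<i> * b0 + (of_nat n + 1) * a0) * \<alpha> (int n) * cnj (\<alpha> (int n - 1))"
proof -
  obtain m where m: "n = Suc m" using n by (cases n) auto
  have "s_diag n * norm2 n = moment_pairing c (remainder n) (int n)"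
    by (simp add: remainder_eq[OF n] norm2_def)
  also have "\<dots> = moment_pairing c (A * pderiv (\<Phi> n)) (int n)
      - s_lower n * moment_pairing c (\<Phi> m) (int m + 1)"
    using n by (simp add: remainder_def pairing_reciprocal orthogonal m add.commute[of 1 "int m"])
  also have "moment_pairing c (A * pderiv (\<Phi> n)) (int n)
      = (\<i> * b1 + (of_nat n + 1) * a1 - (\<i> * b0 + (of_nat n + 1) * a0) * cnj (\<gamma> (Suc n))) * norm2 n"
    using n pairing_Suc_degree[of n]
    by (simp add: pairing_pderiv orthogonal algebra_simps flip: norm2_def)
  also have "s_lower n * moment_pairing c (\<Phi> m) (int m + 1)
      = - (\<i> * b0 + of_nat n * a0) * cnj (\<gamma> n) * norm2 n"
    using pairing_Suc_degree[of m]
      s_lower_norm2[of m, THEN arg_cong, of "\<lambda>x. - cnj (\<gamma> n) * x"]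
    by (simp add: m algebra_simps)
  finally have "s_diag n * norm2 n = (\<i> * b1 + (of_nat n + 1) * a1
      - (\<i> * b0 + (of_nat n + 1) * a0) * cnj (\<gamma> (Suc n))
      + (\<i> * b0 + of_nat n * a0) * cnj (\<gamma> n)) * norm2 n"
    by (simp add: algebra_simps)
  then have "s_diag n = \<i> * b1 + (of_nat n + 1) * a1
      - (\<i> * b0 + (of_nat n + 1) * a0) * cnj (\<gamma> (Suc n)) + (\<i> * b0 + of_nat n * a0) * cnj (\<gamma> n)"
    using norm2_nonzero by simp
  then show ?thesis by (simp add: gamma_Suc algebra_simps)
qed

end

section \<open>Moments of a weight on the circle\<close>

definition trig_moment :: "(real \<Rightarrow> real) \<Rightarrow> int \<Rightarrow> complex" where
  "trig_moment w k = (LINT \<theta>:{0..2*pi}|lebesgue. cis (of_int k * \<theta>) * complex_of_real (w \<theta>))"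

lemma set_integrable_continuous_mult_weight:
  assumes w: "circle_weight w" and g: "continuous_on {0..2*pi} g"
  shows "set_integrable lebesgue {0..2*pi} (\<lambda>\<theta>. g \<theta> * complex_of_real (w \<theta>))"
proof (rule absolutely_integrable_bounded_measurable_product[where h = "(*)" and f = g])
  show "bilinear ((*) :: complex \<Rightarrow> complex \<Rightarrow> complex)"
    using bilinear_conv_bounded_bilinear bounded_bilinear_mult by blast
  show "g \<in> borel_measurable (lebesgue_on {0..2*pi})"
    using g by (rule continuous_imp_measurable_on_sets_lebesgue) simp
  show "bounded (g ` {0..2*pi})"
    using compact_continuous_image[OF g] by (simp add: compact_imp_bounded)
  have "set_integrable lebesgue {0..2*pi} w" using w by (simp add: circle_weight_def)
  then show "set_integrable lebesgue {0..2*pi} (\<lambda>\<theta>. complex_of_real (w \<theta>))"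
    using absolutely_integrable_linear[OF _ bounded_linear_of_real] by (fastforce simp: o_def)
qed simp

lemma set_lebesgue_integral_sum:
  fixes f :: "'i \<Rightarrow> 'a \<Rightarrow> 'b::{banach, second_countable_topology}"
  assumes "\<And>i. i \<in> I \<Longrightarrow> set_integrable M S (f i)"
  shows "(LINT x:S|M. (\<Sum>i\<in>I. f i x)) = (\<Sum>i\<in>I. LINT x:S|M. f i x)"
  using assms unfolding set_lebesgue_integral_def set_integrable_def
  by (simp add: scaleR_sum_right)

lemma poly_cis_mult_cis:
  "poly p (cis \<theta>) * cis (- (of_int k * \<theta>)) = (\<Sum>j\<le>degree p. coeff p j * cis (of_int (int j - k) * \<theta>))"
  unfolding poly_altdef sum_distrib_right
  by (intro sum.cong) (auto simp: Complex.DeMoivre cis_mult algebra_simps)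

lemma moment_pairing_eq_integral:
  assumes w: "circle_weight w"
  shows "moment_pairing (trig_moment w) p k
    = (LINT \<theta>:{0..2*pi}|lebesgue. poly p (cis \<theta>) * cis (- (of_int k * \<theta>)) * complex_of_real (w \<theta>))"
proof -
  have "set_integrable lebesgue {0..2*pi}
      (\<lambda>\<theta>. coeff p j * (cis (of_int (int j - k) * \<theta>) * complex_of_real (w \<theta>)))" for j
    unfolding mult.assoc[symmetric]
    by (intro set_integrable_continuous_mult_weight[OF w] continuous_intros)
  then show ?thesis
    unfolding poly_cis_mult_cis sum_distrib_right mult.assoc
    by (subst set_lebesgue_integral_sum) (simp_all add: moment_pairing_def trig_moment_def)
qed

lemma circle_inner_power:
  assumes w: "circle_weight w"
  shows "circle_inner w (poly p) (\<lambda>z. z ^ k) = moment_pairing (trig_moment w) p (int k)"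
  unfolding circle_inner_def moment_pairing_eq_integral[OF w]
  by (simp add: Complex.DeMoivre cis_cnj)

lemma trig_moment_minus: "trig_moment w (- k) = cnj (trig_moment w k)"
proof -
  have "trig_moment w (- k) = (LINT \<theta>|lebesgue. cnj (indicator {0..2*pi} \<theta> *\<^sub>R
      (cis (of_int k * \<theta>) * complex_of_real (w \<theta>))))"
    unfolding trig_moment_def set_lebesgue_integral_def by (simp add: cis_cnj)
  then show ?thesis
    unfolding trig_moment_def set_lebesgue_integral_def by (simp only: Bochner_Integration.integral_cnj)
qed

text \<open>
  A nonzero polynomial has finitely many roots, and \<open>cis\<close> is injective on the half circle
  \<open>0 \<le> \<theta> \<le> \<pi>\<close> because \<open>cos\<close> is. So \<open>p\<close> vanishes at \<open>cis \<theta>\<close> for finitely many such \<open>\<theta>\<close> only,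
  not for almost all of them.
\<close>

lemma poly_eq_0_if_AE_cis:
  assumes "AE \<theta> in lebesgue. \<theta> \<in> {0..2*pi} \<longrightarrow> poly p (cis \<theta>) = 0"
  shows "p = 0"
proof (rule ccontr)
  assume "p \<noteq> 0"
  obtain N where N: "negligible N" "{\<theta>. \<not> (\<theta> \<in> {0..2*pi} \<longrightarrow> poly p (cis \<theta>) = 0)} \<subseteq> N"
    using assms unfolding eventually_ae_filter_negligible by blast
  let ?Z = "{\<theta> \<in> {0..pi}. poly p (cis \<theta>) = 0}"
  have "inj_on cis {0..pi}"
    by (rule inj_onI) (metis atLeastAtMost_iff cis.sel(1) cos_inj_pi)
  then have "inj_on cis ?Z" by (rule inj_on_subset) auto
  moreover have "finite (cis ` ?Z)"
    by (rule finite_subset[OF _ poly_roots_finite[OF \<open>p \<noteq> 0\<close>]]) auto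
  ultimately have "finite ?Z" by (rule finite_imageD[rotated])
  then have "negligible (?Z \<union> N)" using N by (simp add: negligible_finite)
  moreover have "{0..pi} \<subseteq> ?Z \<union> N" using N by auto
  ultimately have "negligible {0..pi}" by (rule negligible_subset)
  then show False
    using negligible_interval(1)[of 0 pi] pi_gt_zero by (simp add: box_real)
qed

text \<open>
  Orthogonality to all powers up to the degree gives \<open>\<integral> |p|\<^sup>2 w = 0\<close>, and \<open>w\<close> is positive almost
  everywhere.
\<close>

lemma moment_pairing_definite:
  assumes w: "circle_weight w"
    and deg: "\<And>j. j \<ge> n \<Longrightarrow> coeff p j = 0"
    and orth: "\<And>k. k < n \<Longrightarrow> moment_pairing (trig_moment w) p (int k) = 0"
  shows "p = 0"
proof -
  let ?I = "{0..2*pi}"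
  let ?f = "\<lambda>\<theta>. (cmod (poly p (cis \<theta>)))\<^sup>2 * w \<theta>"
  have cont: "continuous_on ?I (\<lambda>\<theta>. poly p (cis \<theta>) * cis (- (of_int k * \<theta>)))" for k
    by (intro continuous_intros)
  have sq: "complex_of_real (?f \<theta>)
      = (\<Sum>k\<le>degree p. cnj (coeff p k) *
          (poly p (cis \<theta>) * cis (- (of_int (int k) * \<theta>)) * complex_of_real (w \<theta>)))" for \<theta>
  proof -
    have "cnj (poly p (cis \<theta>)) = (\<Sum>k\<le>degree p. cnj (coeff p k) * cis (- (of_int (int k) * \<theta>)))"
      by (simp add: poly_altdef Complex.DeMoivre cis_cnj)
    then show ?thesis
      by (simp only: of_real_mult complex_norm_square sum_distrib_left sum_distrib_right mult_ac)
  qed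
  have int_f: "set_integrable lebesgue ?I (\<lambda>\<theta>. complex_of_real (?f \<theta>))"
    unfolding of_real_mult
    by (intro set_integrable_continuous_mult_weight[OF w] continuous_intros)
  have "(LINT \<theta>:?I|lebesgue. complex_of_real (?f \<theta>))
      = (\<Sum>k\<le>degree p. cnj (coeff p k) * moment_pairing (trig_moment w) p (int k))"
    unfolding sq moment_pairing_eq_integral[OF w]
    by (subst set_lebesgue_integral_sum)
      (auto intro!: set_integrable_mult_right set_integrable_continuous_mult_weight[OF w] cont
        simp del: of_int_of_nat_eq)
  also have "\<dots> = 0"
    using orth deg by (intro sum.neutral) (metis complex_cnj_zero mult_zero_left mult_zero_right not_less)
  finally have zero: "(LINT \<theta>|lebesgue. indicator ?I \<theta> * ?f \<theta>) = 0"
    unfolding set_lebesgue_integral_def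
    by (simp add: scaleR_conv_of_real flip: of_real_mult)
  have int': "integrable lebesgue (\<lambda>\<theta>. indicator ?I \<theta> * ?f \<theta>)"
    using integrable_Re[OF int_f[unfolded set_integrable_def]] by simp
  have "AE \<theta> in lebesgue. 0 \<le> indicator ?I \<theta> * ?f \<theta>"
    using w by (intro AE_I2) (auto simp: circle_weight_def indicator_def)
  then have "AE \<theta> in lebesgue. indicator ?I \<theta> * ?f \<theta> = 0"
    using integral_nonneg_eq_0_iff_AE[OF int'] zero by simp
  moreover have "AE \<theta> in lebesgue. \<theta> \<in> ?I \<longrightarrow> 0 < w \<theta>"
    using w by (simp add: circle_weight_def)
  ultimately have "AE \<theta> in lebesgue. \<theta> \<in> ?I \<longrightarrow> poly p (cis \<theta>) = 0"
    by eventually_elim auto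
  then show ?thesis by (rule poly_eq_0_if_AE_cis)
qed

text \<open>
  The function \<open>cis (k \<theta>) F \<theta>\<close> is absolutely continuous with equal values at both ends of the
  interval. Almost everywhere \<open>F = A w\<close>, and its derivative is \<open>cis (k \<theta>)\<close> times the polynomial
  \<open>B + i k A\<close> times \<open>w\<close>. Hence that polynomial is orthogonal to \<open>z^(-k)\<close>.
\<close>

lemma pearson_trig_moments:
  fixes a0 a1 a2 b0 b1 b2 :: complex and k :: int
  assumes w: "circle_weight w"
    and pearson: "pearson_equation [:a0, a1, a2:] [:b0, b1, b2:] w F"
    and boundary: "F (2*pi) = F 0"
  shows "(b0 + \<i> * of_int k * a0) * trig_moment w k + (b1 + \<i> * of_int k * a1) * trig_moment w (k + 1)
     + (b2 + \<i> * of_int k * a2) * trig_moment w (k + 2) = 0"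
proof -
  let ?A = "[:a0, a1, a2:]" and ?B = "[:b0, b1, b2:]" and ?I = "{0..2*pi}"
  let ?Q = "?B + smult (\<i> * of_int k) ?A"
  let ?g = "\<lambda>\<theta>. poly ?Q (cis \<theta>) * cis (- (of_int (- k) * \<theta>)) * complex_of_real (w \<theta>)"
  have ac: "abs_continuous_on_interval 0 (2*pi) F"
    using pearson by (simp add: pearson_equation_def)
  have "AE \<theta> in lebesgue. \<theta> \<in> ?I \<longrightarrow>
      F \<theta> = poly ?A (cis \<theta>) * complex_of_real (w \<theta>) \<and>
      (F has_vector_derivative poly ?B (cis \<theta>) * complex_of_real (w \<theta>)) (at \<theta> within ?I)"
    using pearson unfolding pearson_equation_def by auto
  then obtain N where N: "negligible N" and off: "\<And>\<theta>. \<theta> \<in> ?I - N \<Longrightarrow>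
      F \<theta> = poly ?A (cis \<theta>) * complex_of_real (w \<theta>) \<and>
      (F has_vector_derivative poly ?B (cis \<theta>) * complex_of_real (w \<theta>)) (at \<theta> within ?I)"
    unfolding eventually_ae_filter_negligible by blast
  have "(?g has_integral (cis (of_int k * (2*pi)) * F (2*pi) - cis (of_int k * 0) * F 0)) ?I"
  proof (rule abs_continuous_fundamental_theorem[OF _ abs_continuous_on_interval_cis_mult[OF ac] N])
    fix \<theta> assume \<theta>: "\<theta> \<in> ?I - N"
    have "((\<lambda>\<theta>. cis (of_int k * \<theta>)) has_vector_derivative
        \<i> * of_int k * cis (of_int k * \<theta>)) (at \<theta> within ?I)"
    proof -
      have "((\<lambda>z. exp (\<i> * of_int k * z)) has_field_derivative
          \<i> * of_int k * exp (\<i> * of_int k * of_real \<theta>)) (at (of_real \<theta>))"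
        by (auto intro!: derivative_eq_intros)
      from has_vector_derivative_real_field[OF this] show ?thesis
        by (simp add: cis_conv_exp mult.assoc)
    qed
    from has_vector_derivative_mult[OF this conjunct2[OF off[OF \<theta>]]]
    show "((\<lambda>\<theta>. cis (of_int k * \<theta>) * F \<theta>) has_vector_derivative ?g \<theta>) (at \<theta> within ?I)"
      by (rule has_vector_derivative_eq_rhs) (simp add: off[OF \<theta>] algebra_simps)
  qed simp
  moreover have "cis (of_int k * (2*pi)) = 1"
    by (metis cis_2pi cis_power_int power_int_1_left)
  ultimately have "(?g has_integral 0) ?I" by (simp add: boundary)
  moreover have "set_integrable lebesgue ?I ?g"
    by (intro set_integrable_continuous_mult_weight[OF w] continuous_intros)
  ultimately have "moment_pairing (trig_moment w) ?Q (- k) = 0"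
    unfolding moment_pairing_eq_integral[OF w]
    using has_integral_set_lebesgue has_integral_unique by blast
  moreover have "degree ?Q \<le> 2" by simp
  ultimately show ?thesis
    using moment_pairing_eq_sum[of ?Q 2 "trig_moment w" "- k"]
    by (simp add: numeral_2_eq_2 add.commute)
qed

section \<open>The structure relation for a weight with a Pearson equation\<close>

theorem theorem2p1:
  fixes a0 a1 a2 b0 b1 b2 :: complex
    and A B :: "complex poly"
    and w :: "real \<Rightarrow> real"
    and F :: "real \<Rightarrow> complex"
    and \<Phi> :: "nat \<Rightarrow> complex poly"
    and \<alpha> :: "int \<Rightarrow> complex"
    and \<gamma> t :: "nat \<Rightarrow> complex"
    and s :: "nat \<Rightarrow> nat \<Rightarrow> complex"
  assumes A: "A = [:a0, a1, a2:]" and A_nonzero: "A \<noteq> 0"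
    and B: "B = [:b0, b1, b2:]"
    and weight: "circle_weight w"
    and pearson: "pearson_equation A B w F"
    and boundary: "F (2 * pi) - F 0 = 0"
    and mopuc: "is_mopuc w \<Phi>"
    and \<alpha>: "\<alpha> = verblunsky \<Phi>"
    and \<gamma>: "\<gamma> = verblunsky_gamma \<alpha>"
    and t: "\<And>n. n \<ge> 2 \<Longrightarrow> t n = (\<i> * b2 + a2) * cnj (\<alpha> (int n))"
    and s_lower: "\<And>n. n \<ge> 2 \<Longrightarrow>
          s n (n - 1) = (\<i> * b0 + of_nat n * a0) * (1 - of_real ((cmod (\<alpha> (int n - 1)))\<^sup>2))"
    and s_diag: "\<And>n. n \<ge> 2 \<Longrightarrow>
          s n n = of_nat n * a1 - a2 * \<gamma> n
                  + (\<i> * b2 - (of_nat n - 1) * a2) * cnj (\<alpha> (int n)) * \<alpha> (int n - 1)"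
  shows "\<forall>n\<ge>2.
     (\<forall>z. poly A z * poly (pderiv (\<Phi> n)) z =
            of_nat n * a2 * poly (\<Phi> (n + 1)) z + s n n * poly (\<Phi> n) z
            + s n (n - 1) * poly (\<Phi> (n - 1)) z + t n * poly (reciprocal_poly (\<Phi> n)) z) \<and>
     s n n = \<i> * b1 + (of_nat n + 1) * a1 - a0 * cnj (\<gamma> n)
             - (\<i> * b0 + (of_nat n + 1) * a0) * \<alpha> (int n) * cnj (\<alpha> (int n - 1))"
proof -
  have \<Phi>: "degree (\<Phi> n) = n" "coeff (\<Phi> n) n = 1" for n
    using mopuc unfolding is_mopuc_def by metis+
  have orth: "moment_pairing (trig_moment w) (\<Phi> n) k = 0" if "0 \<le> k" "k < int n" for n k
  proof -
    obtain m where "k = int m" using \<open>0 \<le> k\<close> by (rule nonneg_int_cases)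
    then show ?thesis
      using mopuc that circle_inner_power[OF weight, of "\<Phi> n" m] by (simp add: is_mopuc_def)
  qed
  interpret M: semiclassical_moments "trig_moment w" \<Phi> A a0 a1 a2 b0 b1 b2
  proof
    fix k show "trig_moment w (- k) = cnj (trig_moment w k)" by (rule trig_moment_minus)
  next
    fix n p assume "\<And>j. j \<ge> n \<Longrightarrow> coeff p j = 0"
      and "\<And>k. k < n \<Longrightarrow> moment_pairing (trig_moment w) p (int k) = 0"
    then show "p = 0" by (rule moment_pairing_definite[OF weight])
  next
    fix k
    show "(b0 + \<i> * of_int k * a0) * trig_moment w k + (b1 + \<i> * of_int k * a1) * trig_moment w (k + 1)
        + (b2 + \<i> * of_int k * a2) * trig_moment w (k + 2) = 0"
      using pearson boundary by (intro pearson_trig_moments[OF weight, where F = F]) (auto simp: A B)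
  qed (use A \<Phi> orth in auto)
  show ?thesis
  proof (intro allI impI)
    fix n :: nat assume n: "n \<ge> 2"
    have s: "s n n = M.s_diag n" "s n (n - 1) = M.s_lower n" "t n = M.t_coeff n"
      using s_diag[OF n] s_lower[OF n] t[OF n]
      by (simp_all add: M.s_diag_def M.s_lower_def M.t_coeff_def \<alpha> \<gamma>)
    have "poly (A * pderiv (\<Phi> n)) z = of_nat n * a2 * poly (\<Phi> (n + 1)) z + s n n * poly (\<Phi> n) z
            + s n (n - 1) * poly (\<Phi> (n - 1)) z + t n * poly (reciprocal_poly (\<Phi> n)) z" for z
      unfolding M.structure_relation[OF n] s by simp
    then show "(\<forall>z. poly A z * poly (pderiv (\<Phi> n)) z =
            of_nat n * a2 * poly (\<Phi> (n + 1)) z + s n n * poly (\<Phi> n) z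
            + s n (n - 1) * poly (\<Phi> (n - 1)) z + t n * poly (reciprocal_poly (\<Phi> n)) z) \<and>
     s n n = \<i> * b1 + (of_nat n + 1) * a1 - a0 * cnj (\<gamma> n)
             - (\<i> * b0 + (of_nat n + 1) * a0) * \<alpha> (int n) * cnj (\<alpha> (int n - 1))"
      using M.s_diag_alternative[OF n] s(1) by (simp add: \<alpha> \<gamma>)
  qed
qed

end
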